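(* Let $X$ and $Y$ be separable Hilbert spaces, $\sigma > 0$, and let $Q$ be a self-adjoint, positive, trace class operator on $Y$. Let $V = \operatorname{ran}(Q^{1/2})$ be equipped with the norm $\|\cdot\|_V = \|Q^{-1/2}\cdot\|_Y$, and let $V'$ be its topological dual. Let $F: X \to Y$ satisfy $\operatorname{ran}(F) \subseteq V$, assume that $F$ is Lipschitz continuous on bounded sets as a mapping from $X$ to $V$, and that there exists $L_0 > 0$ such that $$\|F(u) - F(0)\|_V \le L_0\|u\|_X \quad \text{for all } u \in X.$$ Define $\Phi: X \times V' \to \mathbb{R}$ by $$\Phi(u,y) = \frac{1}{2\sigma^2}\|F(u)\|_Y^2 - \frac{1}{\sigma^2}\langle y, F(u)\rangle_{V'\times V} .$$ Then for every $y \in V'$: (i) $\Phi(\cdot,y)$ is Lipschitz continuous on bounded sets; (ii) there exists $\underline{L} \ge 0$ such that $\Phi(u,y) \ge \Phi(0,y) - \underline{L}\|u\|_X$ for all $u \in X$.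
   Context: $\operatorname{ran}$ denotes the range of a mapping. $Q^{-1/2}$ denotes the inverse of $Q^{1/2}$ (restricted to $(\ker Q)^\perp$ if $Q$ is not injective) defined on $\operatorname{ran}(Q^{1/2})$. $\langle\cdot,\cdot\rangle_{V'\times V}$ is the dual pairing. A map $G$ from $X$ into a normed space $W$ is Lipschitz continuous on bounded sets if for every $r > 0$ there exists $L = L(r) > 0$ such that $\|G(x_1) - G(x_2)\|_W \le L\|x_1 - x_2\|_X$ for all $x_1, x_2$ in the open ball $B_r(0) \subset X$. *)

theory Defs
  imports "HOL-Analysis.Analysis"
begin

text \<open>
  A real Hilbert space is a type of sort \<open>{real_inner, complete_space}\<close>; a separable one is a type of
  sort \<open>{real_inner, polish_space}\<close>. Operators are plain functions, whose linearity and
  boundedness are part of the predicates below. Positive means nonnegative: a nontrivial kernel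
  is allowed.
\<close>

definition selfadjoint_op :: "('a::real_inner \<Rightarrow> 'a) \<Rightarrow> bool" where
  "selfadjoint_op T \<longleftrightarrow> bounded_linear T \<and> (\<forall>x y. T x \<bullet> y = x \<bullet> T y)"

definition positive_op :: "('a::real_inner \<Rightarrow> 'a) \<Rightarrow> bool" where
  "positive_op T \<longleftrightarrow> (\<forall>x. 0 \<le> T x \<bullet> x)"

text \<open>On a Hilbert space, a positive self-adjoint operator has exactly one positive self-adjoint
  square root, so the description below is proper for every such \<open>T\<close>.\<close>

definition op_sqrt :: "('a::real_inner \<Rightarrow> 'a) \<Rightarrow> 'a \<Rightarrow> 'a" where
  "op_sqrt T = (THE S. selfadjoint_op S \<and> positive_op S \<and> S \<circ> S = T)"

definition op_abs :: "('a::real_inner \<Rightarrow> 'a) \<Rightarrow> 'a \<Rightarrow> 'a" where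
  "op_abs T = op_sqrt (adjoint T \<circ> T)"

definition orthonormal_basis :: "'a::real_inner set \<Rightarrow> bool" where
  "orthonormal_basis B \<longleftrightarrow>
     pairwise orthogonal B \<and> (\<forall>e\<in>B. norm e = 1) \<and> closure (span B) = UNIV"

text \<open>Finiteness of the trace of \<open>op_abs T\<close> does not depend on the orthonormal basis. It is demanded
  for some basis rather than for all of them, so that the condition cannot hold vacuously.\<close>

definition trace_class :: "('a::real_inner \<Rightarrow> 'a) \<Rightarrow> bool" where
  "trace_class T \<longleftrightarrow> bounded_linear T \<and>
     (\<exists>B. orthonormal_basis B \<and> (\<lambda>e. op_abs T e \<bullet> e) summable_on B)"

text \<open>\<open>inv_sqrt Q\<close> is meaningful on the range of \<open>op_sqrt Q\<close> only.\<close>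

definition inv_sqrt :: "('a::real_inner \<Rightarrow> 'a) \<Rightarrow> 'a \<Rightarrow> 'a" where
  "inv_sqrt Q = inv_into ({x. Q x = 0}\<^sup>\<bottom>) (op_sqrt Q)"

text \<open>The normed space \<open>V\<close> depends on \<open>Q\<close> and hence is not a type; it is given by its carrier, a
  subset of \<open>Y\<close>, and its norm.\<close>

definition V_space :: "('a::real_inner \<Rightarrow> 'a) \<Rightarrow> 'a set" where
  "V_space Q = range (op_sqrt Q)"

definition V_norm :: "('a::real_inner \<Rightarrow> 'a) \<Rightarrow> 'a \<Rightarrow> real" where
  "V_norm Q v = norm (inv_sqrt Q v)"

text \<open>Elements of \<open>V'\<close> are functionals on \<open>V\<close>, encoded as functions on \<open>Y\<close> that are \<open>undefined\<close>
  off \<open>V\<close>. The dual pairing of \<open>y\<close> and \<open>v\<close> is the application \<open>y v\<close>. Continuity is with respect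
  to \<open>V_norm\<close>, not the norm of \<open>Y\<close>.\<close>

definition V_dual :: "('a::real_inner \<Rightarrow> 'a) \<Rightarrow> ('a \<Rightarrow> real) set" where
  "V_dual Q = {y \<in> extensional (V_space Q).
     (\<forall>v\<in>V_space Q. \<forall>w\<in>V_space Q. y (v + w) = y v + y w) \<and>
     (\<forall>c. \<forall>v\<in>V_space Q. y (c *\<^sub>R v) = c * y v) \<and>
     (\<exists>K. \<forall>v\<in>V_space Q. \<bar>y v\<bar> \<le> K * V_norm Q v)}"

text \<open>The norm of the target space is a parameter, since \<open>V\<close> is not a type.\<close>

definition lipschitz_on_bounded_sets ::
  "('w::ab_group_add \<Rightarrow> real) \<Rightarrow> ('x::real_normed_vector \<Rightarrow> 'w) \<Rightarrow> bool" where
  "lipschitz_on_bounded_sets N G \<longleftrightarrow>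
     (\<forall>r>0. \<exists>L>0. \<forall>x1\<in>ball 0 r. \<forall>x2\<in>ball 0 r. N (G x1 - G x2) \<le> L * norm (x1 - x2))"

definition potential ::
  "real \<Rightarrow> ('x \<Rightarrow> 'y::real_inner) \<Rightarrow> 'x \<Rightarrow> ('y \<Rightarrow> real) \<Rightarrow> real" where
  "potential \<sigma> F u y = 1 / (2 * \<sigma>\<^sup>2) * (norm (F u))\<^sup>2 - 1 / \<sigma>\<^sup>2 * y (F u)"

end

theory Submission
  imports Defs
begin

text \<open>
  Since \<open>op_sqrt\<close> is a definite description, everything rests on the existence and uniqueness of the
  positive square root \<open>S\<close> of \<open>Q\<close>. After scaling, \<open>Q = I - A\<close> with \<open>A\<close> a contraction, and
  \<open>S = I - Y\<close> where \<open>Y\<close> is the pointwise limit of \<open>Y\<^sub>0 = 0\<close>, \<open>Y\<^sub>n\<^sub>+\<^sub>1 = (A + Y\<^sub>n\<^sup>2) / 2\<close>; the increments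
  are dominated by those of the scalar iteration with \<open>A = 1\<close>. Splitting off \<open>ker Q = ker S\<close> then
  shows that \<open>inv_sqrt Q\<close> is a right inverse of \<open>S\<close> on \<open>V\<close>, so the ambient norm is bounded on \<open>V\<close> by a
  multiple of the norm of \<open>V\<close>. With this bound both claims follow from
  \<open>\<parallel>a\<parallel>\<^sup>2 - \<parallel>b\<parallel>\<^sup>2 = \<langle>a - b, a + b\<rangle>\<close> and the continuity of \<open>y\<close> on \<open>V\<close>.
\<close>

section \<open>Orthogonal decomposition\<close>

text \<open>A minimizing sequence is Cauchy: its midpoints stay in the convex set, so their squared
  norm is at least the infimum \<open>d\<close>, and the parallelogram identity then makes the
  differences small. Completeness supplies the limit, closedness keeps it in
  \<open>C\<close>.\<close>

lemma closed_convex_minimal_norm: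
  fixes C :: "'a::{real_inner, complete_space} set"
  assumes "closed C" and "convex C" and "C \<noteq> {}"
  obtains p where "p \<in> C" and "\<And>z. z \<in> C \<Longrightarrow> norm p \<le> norm z"
proof -
  define d where "d = Inf ((\<lambda>z. (norm z)\<^sup>2) ` C)"
  have bdd: "bdd_below ((\<lambda>z. (norm z)\<^sup>2) ` C)"
    by (rule bdd_belowI2[of _ 0]) simp
  have d_le: "d \<le> (norm z)\<^sup>2" if "z \<in> C" for z
    unfolding d_def using bdd that by (rule cINF_lower)
  have "\<exists>z\<in>C. (norm z)\<^sup>2 < d + 1 / real (Suc n)" for n
  proof -
    have "Inf ((\<lambda>z. (norm z)\<^sup>2) ` C) < d + 1 / real (Suc n)"
      unfolding d_def by simp
    then show ?thesis
      using cInf_lessD[of "(\<lambda>z. (norm z)\<^sup>2) ` C"] assms(3) by blast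
  qed
  then obtain X where XC: "X n \<in> C" and Xn: "(norm (X n))\<^sup>2 < d + 1 / real (Suc n)" for n
    by metis
  have dist_sq: "(norm (X m - X n))\<^sup>2 \<le> 2 / real (Suc m) + 2 / real (Suc n)" for m n
  proof -
    have "(1/2) *\<^sub>R X m + (1/2) *\<^sub>R X n \<in> C"
      using assms(2) XC by (intro convexD) auto
    then have "d \<le> (norm ((1/2) *\<^sub>R (X m + X n)))\<^sup>2"
      using d_le by (simp add: scaleR_add_right)
    then have "4 * d \<le> (norm (X m + X n))\<^sup>2"
      by (simp add: power2_eq_square)
    moreover have "(norm (X m - X n))\<^sup>2 = 2 * (norm (X m))\<^sup>2 + 2 * (norm (X n))\<^sup>2 - (norm (X m + X n))\<^sup>2"
      by (simp add: power2_norm_eq_inner inner_add inner_diff inner_commute)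
    ultimately show ?thesis
      using Xn[of m] Xn[of n] by simp
  qed
  have "Cauchy X"
  proof (rule metric_CauchyI)
    fix e :: real
    assume "0 < e"
    then obtain N where N: "4 / e\<^sup>2 < real N"
      using reals_Archimedean2 by blast
    have "dist (X m) (X n) < e" if "m \<ge> N" "n \<ge> N" for m n
    proof -
      have pos: "0 < real N"
        using N \<open>0 < e\<close> by (smt (verit) divide_pos_pos zero_less_power)
      have "2 / real (Suc k) \<le> 2 / real N" if "k \<ge> N" for k
        using that pos by (intro divide_left_mono) auto
      then have "(norm (X m - X n))\<^sup>2 \<le> 2 / real N + 2 / real N"
        using dist_sq[of m n] that by (smt (verit))
      also have "\<dots> < e\<^sup>2"
        using N pos \<open>0 < e\<close> by (simp add: field_simps)
      finally show ?thesis
        using \<open>0 < e\<close> by (simp add: dist_norm power2_less_imp_less)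
    qed
    then show "\<exists>M. \<forall>m\<ge>M. \<forall>n\<ge>M. dist (X m) (X n) < e"
      by blast
  qed
  then obtain p where p: "X \<longlonglongrightarrow> p"
    using Cauchy_convergent convergent_def by blast
  have "p \<in> C"
    using assms(1) XC p closed_sequentially by blast
  moreover have "norm p \<le> norm z" if "z \<in> C" for z
  proof -
    have "(norm p)\<^sup>2 \<le> d"
    proof (rule LIMSEQ_le)
      show "(\<lambda>n. (norm (X n))\<^sup>2) \<longlonglongrightarrow> (norm p)\<^sup>2"
        using p by (intro tendsto_intros)
      show "(\<lambda>n. d + 1 / real (Suc n)) \<longlonglongrightarrow> d"
        using tendsto_add[OF tendsto_const LIMSEQ_Suc[OF lim_1_over_n], of d] by simp
    qed (use Xn less_imp_le in blast)
    then have "(norm p)\<^sup>2 \<le> (norm z)\<^sup>2"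
      using d_le[OF that] by (rule order_trans)
    then show ?thesis
      by simp
  qed
  ultimately show thesis
    by (rule that)
qed

text \<open>The component orthogonal to \<open>K\<close> is the point of least norm in the coset
  \<open>x + K\<close>: shifting it along any \<open>k\<close> in \<open>K\<close> stays in the
  coset and so cannot shorten it.\<close>

lemma orthogonal_decomposition:
  fixes K :: "'a::{real_inner, complete_space} set"
  assumes "subspace K" and "closed K"
  obtains p where "p \<in> K\<^sup>\<bottom>" and "x - p \<in> K"
proof -
  have "closed ((+) x ` K)" "convex ((+) x ` K)" "(+) x ` K \<noteq> {}"
    using closed_translation[OF assms(2)] convex_translation[OF subspace_imp_convex[OF assms(1)]]
      subspace_0[OF assms(1)] by auto
  then obtain p where pC: "p \<in> (+) x ` K" and min: "\<And>z. z \<in> (+) x ` K \<Longrightarrow> norm p \<le> norm z"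
    using closed_convex_minimal_norm by blast
  obtain k0 where k0: "k0 \<in> K" "p = x + k0"
    using pC by blast
  have "p \<bullet> k = 0" if "k \<in> K" for k
  proof (cases "k = 0")
    case False
    \<comment> \<open>The value of \<open>t\<close> at which \<open>p - t *\<^sub>R k\<close> is
      shortest.\<close>
    define t where "t = (p \<bullet> k) / (k \<bullet> k)"
    have "p - t *\<^sub>R k = x + (k0 - t *\<^sub>R k)"
      using k0 by simp
    moreover have "k0 - t *\<^sub>R k \<in> K"
      using assms(1) k0 that by (simp add: subspace_diff subspace_scale)
    ultimately have "norm p \<le> norm (p - t *\<^sub>R k)"
      using min by auto
    then have "p \<bullet> p \<le> (p - t *\<^sub>R k) \<bullet> (p - t *\<^sub>R k)"
      by (simp add: norm_le)
    also have "\<dots> = p \<bullet> p - (p \<bullet> k)\<^sup>2 / (k \<bullet> k)"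
      using False by (simp add: t_def inner_diff inner_commute power2_eq_square)
    finally have "(p \<bullet> k)\<^sup>2 / (k \<bullet> k) \<le> 0"
      by simp
    moreover have "0 < k \<bullet> k"
      using False by simp
    ultimately have "(p \<bullet> k)\<^sup>2 \<le> 0"
      by (simp add: divide_le_0_iff)
    then show ?thesis
      by simp
  qed simp
  then have "p \<in> K\<^sup>\<bottom>"
    by (simp add: orthogonal_comp_def orthogonal_def inner_commute)
  moreover have "x - p \<in> K"
    using k0 subspace_neg[OF assms(1)] by simp
  ultimately show thesis
    by (rule that)
qed

section \<open>The positive square root\<close>

lemma selfadjoint_opD:
  assumes "selfadjoint_op T"
  shows "bounded_linear T" and "T x \<bullet> y = x \<bullet> T y"
  using assms by (auto simp: selfadjoint_op_def)

text \<open>The form \<open>T x \<bullet> y\<close> is a possibly degenerate inner product, so the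
  usual argument applies: a quadratic polynomial in \<open>t\<close> that is never negative.\<close>

lemma positive_op_Cauchy_Schwarz:
  assumes "selfadjoint_op T" and "positive_op T"
  shows "(T x \<bullet> y)\<^sup>2 \<le> (T x \<bullet> x) * (T y \<bullet> y)"
proof -
  interpret bounded_linear T
    using assms(1) by (rule selfadjoint_opD)
  have sym: "T y \<bullet> x = T x \<bullet> y"
    using selfadjoint_opD(2)[OF assms(1), of y x] by (simp add: inner_commute)
  have quad: "0 \<le> T x \<bullet> x + 2 * t * (T x \<bullet> y) + t\<^sup>2 * (T y \<bullet> y)" for t
  proof -
    have "0 \<le> T (x + t *\<^sub>R y) \<bullet> (x + t *\<^sub>R y)"
      using assms(2) by (simp add: positive_op_def)
    then show ?thesis
      by (simp add: add scaleR inner_add sym power2_eq_square algebra_simps)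
  qed
  have nonneg: "0 \<le> T x \<bullet> x" "0 \<le> T y \<bullet> y"
    using assms(2) by (auto simp: positive_op_def)
  show ?thesis
  proof (cases "T y \<bullet> y = 0")
    case True
    have "T x \<bullet> y = 0"
    proof (rule ccontr)
      assume nz: "T x \<bullet> y \<noteq> 0"
      show False
        \<comment> \<open>Without its quadratic term the polynomial is affine; at this
          \<open>t\<close> it would equal -1.\<close>
        using quad[of "- (T x \<bullet> x + 1) / (2 * (T x \<bullet> y))"] nz True by (simp add: field_simps)
    qed
    then show ?thesis
      using True by simp
  next
    case False
    have "0 \<le> T x \<bullet> x - (T x \<bullet> y)\<^sup>2 / (T y \<bullet> y)"
      using quad[of "- (T x \<bullet> y) / (T y \<bullet> y)"] False by (simp add: power2_eq_square)
    then show ?thesis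
      using False nonneg by (simp add: field_simps)
  qed
qed

lemma positive_op_eq_0:
  assumes "selfadjoint_op T" and "positive_op T" and "T x \<bullet> x = 0"
  shows "T x = 0"
  using positive_op_Cauchy_Schwarz[OF assms(1,2), of x "T x"] assms(3) by simp

text \<open>A bound on the quadratic form becomes a bound on the norm: apply the Cauchy-Schwarz
  inequality of the form to \<open>x\<close> and \<open>T x\<close>, then cancel one factor
  \<open>T x \<bullet> T x\<close>.\<close>

lemma positive_op_contraction:
  assumes "selfadjoint_op T" and "positive_op T" and "\<And>x. T x \<bullet> x \<le> x \<bullet> x"
  shows "norm (T x) \<le> norm x"
proof (cases "T x = 0")
  case False
  have "(T x \<bullet> T x)\<^sup>2 \<le> (T x \<bullet> x) * (T (T x) \<bullet> T x)"
    using positive_op_Cauchy_Schwarz[OF assms(1,2)] .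
  also have "\<dots> \<le> (x \<bullet> x) * (T x \<bullet> T x)"
    using assms(2,3) by (intro mult_mono) (auto simp: positive_op_def)
  finally have "T x \<bullet> T x \<le> x \<bullet> x"
    using False by (simp add: power2_eq_square)
  then show ?thesis
    by (simp add: norm_le)
qed simp

section \<open>The square root iteration and its limit\<close>

text \<open>A fixed point \<open>Y\<close> satisfies \<open>2 Y = A + Y\<^sup>2\<close>, which is
  \<open>(I - Y)\<^sup>2 = I - A\<close>.\<close>

primrec sqrt_iter :: "('a::real_vector \<Rightarrow> 'a) \<Rightarrow> nat \<Rightarrow> 'a \<Rightarrow> 'a" where
  "sqrt_iter A 0 = (\<lambda>x. 0)"
| "sqrt_iter A (Suc n) = (\<lambda>x. (1/2) *\<^sub>R (A x + sqrt_iter A n (sqrt_iter A n x)))"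

primrec sqrt_iter_bound :: "nat \<Rightarrow> real" where
  "sqrt_iter_bound 0 = 0"
| "sqrt_iter_bound (Suc n) = (1 + (sqrt_iter_bound n)\<^sup>2) / 2"

lemma sqrt_iter_bound_range: "0 \<le> sqrt_iter_bound n" "sqrt_iter_bound n \<le> 1"
proof -
  have "0 \<le> sqrt_iter_bound n \<and> sqrt_iter_bound n \<le> 1"
    by (induction n) (auto simp: power_le_one)
  then show "0 \<le> sqrt_iter_bound n" "sqrt_iter_bound n \<le> 1"
    by auto
qed

lemma incseq_sqrt_iter_bound: "incseq sqrt_iter_bound"
proof (rule incseq_SucI)
  fix n
  have "0 \<le> (1 - sqrt_iter_bound n)\<^sup>2 / 2"
    by simp
  then show "sqrt_iter_bound n \<le> sqrt_iter_bound (Suc n)"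
    by (simp add: power2_eq_square algebra_simps)
qed

lemma linear_sqrt_iter: "linear A \<Longrightarrow> linear (sqrt_iter A n)"
proof (induction n)
  case 0
  then show ?case
    by (simp add: linear_zero)
next
  case (Suc n)
  then have "linear (\<lambda>x. (1/2) *\<^sub>R (A x + (sqrt_iter A n \<circ> sqrt_iter A n) x))"
    by (intro linear_compose_scale_right linear_compose_add linear_compose) auto
  then show ?case
    by simp
qed

text \<open>The iterates are polynomials in \<open>A\<close>. The case of a general \<open>B\<close>
  passes to the limit and is what the uniqueness of the root needs later.\<close>

lemma sqrt_iter_commute:
  assumes "linear B" and "\<And>x. B (A x) = A (B x)"
  shows "B (sqrt_iter A n x) = sqrt_iter A n (B x)"
  using assms by (induction n arbitrary: x) (simp_all add: linear_0 linear_scale linear_add)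

lemma sqrt_iter_selfadjoint:
  assumes "\<And>x y. A x \<bullet> y = x \<bullet> A y"
  shows "sqrt_iter A n x \<bullet> y = x \<bullet> sqrt_iter A n y"
  using assms by (induction n arbitrary: x y) (simp_all add: inner_add)

context
  fixes A :: "'a::{real_inner, complete_space} \<Rightarrow> 'a"
  assumes lin: "linear A" and contr: "\<And>x. norm (A x) \<le> norm x"
begin

lemma norm_sqrt_iter: "norm (sqrt_iter A n x) \<le> sqrt_iter_bound n * norm x"
proof (induction n arbitrary: x)
  case (Suc n)
  have "norm (sqrt_iter A n (sqrt_iter A n x)) \<le> sqrt_iter_bound n * (sqrt_iter_bound n * norm x)"
    using Suc sqrt_iter_bound_range(1) by (meson mult_left_mono order_trans)
  then have "norm (A x + sqrt_iter A n (sqrt_iter A n x)) \<le> norm x + (sqrt_iter_bound n)\<^sup>2 * norm x"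
    using contr[of x] norm_triangle_mono by (simp add: power2_eq_square mult.assoc)
  then show ?case
    by (simp add: algebra_simps del: scaleR_add_right)
qed simp

lemma norm_sqrt_iter_le: "norm (sqrt_iter A n x) \<le> norm x"
  using norm_sqrt_iter[of n x] sqrt_iter_bound_range(2)[of n]
  by (meson mult_left_le_one_le norm_ge_zero order_trans sqrt_iter_bound_range(1))

text \<open>The iterates commute, so the increment factors as
  \<open>Y\<^sub>n\<^sub>+\<^sub>2 - Y\<^sub>n\<^sub>+\<^sub>1 = (Y\<^sub>n\<^sub>+\<^sub>1 + Y\<^sub>n) (Y\<^sub>n\<^sub>+\<^sub>1 - Y\<^sub>n) / 2\<close>.\<close>

lemma norm_sqrt_iter_increment:
  "norm (sqrt_iter A (Suc n) x - sqrt_iter A n x)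
     \<le> (sqrt_iter_bound (Suc n) - sqrt_iter_bound n) * norm x"
proof (induction n arbitrary: x)
  case 0
  then show ?case
    using contr[of x] by simp
next
  case (Suc n)
  define Y where "Y = sqrt_iter A n"
  define Z where "Z = sqrt_iter A (Suc n)"
  define a where "a = sqrt_iter_bound n"
  define b where "b = sqrt_iter_bound (Suc n)"
  interpret Y: linear Y
    unfolding Y_def using lin by (rule linear_sqrt_iter)
  interpret Z: linear Z
    unfolding Z_def using lin by (rule linear_sqrt_iter)
  \<comment> \<open>\<open>sqrt_iter_commute\<close> enters twice: with \<open>B = A\<close>, so
    that \<open>Y\<close> commutes with \<open>A\<close>, and then with
    \<open>B = Y\<close>.\<close>
  have comm: "Y (Z x) = Z (Y x)"
    unfolding Z_def
    by (rule sqrt_iter_commute[OF Y.linear_axioms]) (simp add: Y_def lin sqrt_iter_commute)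
  define z where "z = Z x - Y x"
  have "sqrt_iter A (Suc (Suc n)) x - sqrt_iter A (Suc n) x = (1/2) *\<^sub>R (Z (Z x) - Y (Y x))"
    unfolding sqrt_iter.simps(2)[of A "Suc n"] sqrt_iter.simps(2)[of A n]
    by (simp add: Y_def Z_def algebra_simps)
  also have "Z (Z x) - Y (Y x) = Z z + Y z"
    by (simp add: z_def Y.diff Z.diff comm)
  finally have eq: "norm (sqrt_iter A (Suc (Suc n)) x - sqrt_iter A (Suc n) x) = norm (Z z + Y z) / 2"
    by simp
  have z: "norm z \<le> (b - a) * norm x"
    using Suc[of x] by (simp only: z_def Y_def Z_def a_def b_def)
  have "norm (Z z + Y z) \<le> b * norm z + a * norm z"
    using norm_sqrt_iter[of "Suc n" z] norm_sqrt_iter[of n z] norm_triangle_mono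
    by (simp only: Z_def Y_def a_def b_def)
  also have "\<dots> = (b + a) * norm z"
    by (simp add: algebra_simps)
  also have "\<dots> \<le> (b + a) * ((b - a) * norm x)"
    using z sqrt_iter_bound_range(1) by (intro mult_left_mono) (simp_all only: a_def b_def add_nonneg_nonneg)
  \<comment> \<open>The product \<open>(b + a) * (b - a)\<close> reproduces the scalar recursion, so
    the induction closes without loss.\<close>
  finally have "norm (Z z + Y z) / 2 \<le> (b\<^sup>2 - a\<^sup>2) / 2 * norm x"
    by (simp add: power2_eq_square algebra_simps)
  also have "(b\<^sup>2 - a\<^sup>2) / 2 = sqrt_iter_bound (Suc (Suc n)) - sqrt_iter_bound (Suc n)"
    unfolding sqrt_iter_bound.simps(2)[of "Suc n"] sqrt_iter_bound.simps(2)[of n]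
    by (simp add: a_def b_def field_simps)
  finally show ?case
    unfolding eq .
qed

lemma norm_sqrt_iter_diff:
  assumes "n \<le> m"
  shows "norm (sqrt_iter A m x - sqrt_iter A n x) \<le> (sqrt_iter_bound m - sqrt_iter_bound n) * norm x"
  using assms
proof (induction m rule: dec_induct)
  case (step m)
  have "norm (sqrt_iter A (Suc m) x - sqrt_iter A n x)
      \<le> norm (sqrt_iter A (Suc m) x - sqrt_iter A m x) + norm (sqrt_iter A m x - sqrt_iter A n x)"
    using norm_triangle_ineq[of "sqrt_iter A (Suc m) x - sqrt_iter A m x" "sqrt_iter A m x - sqrt_iter A n x"]
    by (simp only: diff_add_cancel add_diff_eq)
  also have "\<dots> \<le> (sqrt_iter_bound (Suc m) - sqrt_iter_bound n) * norm x"
    using norm_sqrt_iter_increment[of m x] step.IH by (simp only: left_diff_distrib)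
  finally show ?case .
qed simp

text \<open>The scalar sequence is increasing and bounded by 1, hence Cauchy, and it dominates the
  differences of the iterates at \<open>x\<close>.\<close>

lemma convergent_sqrt_iter: "convergent (\<lambda>n. sqrt_iter A n x)"
proof (rule Cauchy_convergent, rule metric_CauchyI)
  fix e :: real
  assume "0 < e"
  have "Cauchy sqrt_iter_bound"
    using incseq_convergent[OF incseq_sqrt_iter_bound, of 1] sqrt_iter_bound_range(2)
      LIMSEQ_imp_Cauchy by blast
  \<comment> \<open>Adding 1 to \<open>norm x\<close> covers \<open>x = 0\<close>.\<close>
  moreover have "0 < e / (norm x + 1)"
    using \<open>0 < e\<close> by (simp add: add_nonneg_pos)
  ultimately obtain N
    where N: "\<And>m n. m \<ge> N \<Longrightarrow> n \<ge> N \<Longrightarrow> \<bar>sqrt_iter_bound m - sqrt_iter_bound n\<bar> < e / (norm x + 1)"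
    unfolding Cauchy_def dist_real_def by blast
  have le: "dist (sqrt_iter A m x) (sqrt_iter A n x) \<le> \<bar>sqrt_iter_bound m - sqrt_iter_bound n\<bar> * norm x"
    for m n
  proof (cases "n \<le> m")
    case True
    have "norm (sqrt_iter A m x - sqrt_iter A n x) \<le> (sqrt_iter_bound m - sqrt_iter_bound n) * norm x"
      using True by (rule norm_sqrt_iter_diff)
    also have "\<dots> \<le> \<bar>sqrt_iter_bound m - sqrt_iter_bound n\<bar> * norm x"
      by (intro mult_right_mono) auto
    finally show ?thesis
      by (simp add: dist_norm)
  next
    case False
    then have "norm (sqrt_iter A n x - sqrt_iter A m x) \<le> (sqrt_iter_bound n - sqrt_iter_bound m) * norm x"
      by (intro norm_sqrt_iter_diff) simp
    also have "\<dots> \<le> \<bar>sqrt_iter_bound m - sqrt_iter_bound n\<bar> * norm x"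
      by (intro mult_right_mono) auto
    finally show ?thesis
      by (simp add: dist_norm norm_minus_commute)
  qed
  have "dist (sqrt_iter A m x) (sqrt_iter A n x) < e" if "m \<ge> N" "n \<ge> N" for m n
  proof -
    have "\<bar>sqrt_iter_bound m - sqrt_iter_bound n\<bar> * norm x
        \<le> \<bar>sqrt_iter_bound m - sqrt_iter_bound n\<bar> * (norm x + 1)"
      by (intro mult_left_mono) auto
    also have "\<dots> < e"
      using N[OF that] by (simp add: pos_less_divide_eq add_nonneg_pos)
    finally show ?thesis
      using le[of m n] by simp
  qed
  then show "\<exists>M. \<forall>m\<ge>M. \<forall>n\<ge>M. dist (sqrt_iter A m x) (sqrt_iter A n x) < e"
    by blast
qed

end

lemma contraction_sqrt_fixpoint:
  fixes A :: "'a::{real_inner, complete_space} \<Rightarrow> 'a"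
  assumes "selfadjoint_op A" and contr: "\<And>x. norm (A x) \<le> norm x"
  obtains Y where "selfadjoint_op Y" and "\<And>x. norm (Y x) \<le> norm x"
    and "\<And>x. 2 *\<^sub>R Y x = A x + Y (Y x)"
    and "\<And>B x. bounded_linear B \<Longrightarrow> (\<And>z. B (A z) = A (B z)) \<Longrightarrow> B (Y x) = Y (B x)"
proof -
  have linA: "linear A"
    using selfadjoint_opD(1)[OF assms(1)] by (rule bounded_linear.linear)
  define Y where "Y x = lim (\<lambda>n. sqrt_iter A n x)" for x
  have lim: "(\<lambda>n. sqrt_iter A n x) \<longlonglongrightarrow> Y x" for x
    unfolding Y_def using convergent_sqrt_iter[OF linA contr] convergent_LIMSEQ_iff by blast
  note lin_iter = linear_sqrt_iter[OF linA]
  have Y_le: "norm (Y x) \<le> norm x" for x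
    using norm_sqrt_iter_le[OF linA contr]
    by (intro LIMSEQ_le_const2[OF tendsto_norm[OF lim]]) auto
  have "bounded_linear Y"
  proof (rule bounded_linear_intro[where K = 1])
    fix x y and r :: real
    have "(\<lambda>n. sqrt_iter A n (x + y)) \<longlonglongrightarrow> Y x + Y y"
      using tendsto_add[OF lim[of x] lim[of y]] by (simp add: linear_add[OF lin_iter])
    then show "Y (x + y) = Y x + Y y"
      using lim LIMSEQ_unique by blast
    have "(\<lambda>n. sqrt_iter A n (r *\<^sub>R x)) \<longlonglongrightarrow> r *\<^sub>R Y x"
      using tendsto_scaleR[OF tendsto_const lim[of x], of r] by (simp add: linear_scale[OF lin_iter])
    then show "Y (r *\<^sub>R x) = r *\<^sub>R Y x"
      using lim LIMSEQ_unique by blast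
  qed (use Y_le in simp)
  moreover have "Y x \<bullet> y = x \<bullet> Y y" for x y
  proof -
    have "(\<lambda>n. sqrt_iter A n x \<bullet> y) \<longlonglongrightarrow> Y x \<bullet> y"
      by (intro tendsto_intros lim)
    moreover have "(\<lambda>n. x \<bullet> sqrt_iter A n y) \<longlonglongrightarrow> x \<bullet> Y y"
      by (intro tendsto_intros lim)
    ultimately show ?thesis
      using LIMSEQ_unique by (simp add: sqrt_iter_selfadjoint selfadjoint_opD(2)[OF assms(1)])
  qed
  ultimately have "selfadjoint_op Y"
    by (simp add: selfadjoint_op_def)
  moreover have "2 *\<^sub>R Y x = A x + Y (Y x)" for x
  proof -
    \<comment> \<open>Pointwise convergence passes to the composed iterates because all of them are
      contractions.\<close>
    have "(\<lambda>n. sqrt_iter A n (sqrt_iter A n x - Y x)) \<longlonglongrightarrow> 0"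
    proof (rule Lim_null_comparison)
      show "\<forall>\<^sub>F n in sequentially.
          norm (sqrt_iter A n (sqrt_iter A n x - Y x)) \<le> norm (sqrt_iter A n x - Y x)"
        using norm_sqrt_iter_le[OF linA contr] by simp
      show "(\<lambda>n. norm (sqrt_iter A n x - Y x)) \<longlonglongrightarrow> 0"
        using lim[of x] by (simp add: LIM_zero tendsto_norm_zero)
    qed
    from tendsto_add[OF this lim[of "Y x"]]
    have "(\<lambda>n. sqrt_iter A n (sqrt_iter A n x)) \<longlonglongrightarrow> Y (Y x)"
      by (simp add: linear_diff[OF lin_iter])
    then have "(\<lambda>n. sqrt_iter A (Suc n) x) \<longlonglongrightarrow> (1/2) *\<^sub>R (A x + Y (Y x))"
      by (simp, intro tendsto_intros)
    then have "Y x = (1/2) *\<^sub>R (A x + Y (Y x))"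
      using LIMSEQ_Suc[OF lim[of x]] LIMSEQ_unique by blast
    then show ?thesis
      by (metis scaleR_half_double scaleR_2 scaleR_add_right)
  qed
  moreover have "B (Y x) = Y (B x)"
    if "bounded_linear B" and "\<And>z. B (A z) = A (B z)" for B x
  proof -
    have "(\<lambda>n. B (sqrt_iter A n x)) \<longlonglongrightarrow> B (Y x)"
      using that(1) lim by (rule bounded_linear.tendsto)
    moreover have "B (sqrt_iter A n x) = sqrt_iter A n (B x)" for n
      using bounded_linear.linear[OF that(1)] that(2) by (rule sqrt_iter_commute)
    ultimately show ?thesis
      using lim[of "B x"] LIMSEQ_unique by simp
  qed
  ultimately show thesis
    using that Y_le by blast
qed

section \<open>Existence and uniqueness of the positive square root\<close>

text \<open>If \<open>c\<close> bounds the norm of \<open>Q\<close>, then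
  \<open>A = I - Q / c\<close> is a positive contraction, and its fixed point \<open>Y\<close> gives
  the root \<open>sqrt c * (I - Y)\<close>. Whatever commutes with \<open>Q\<close> commutes with
  \<open>A\<close>, hence with the root.\<close>

lemma positive_sqrt_exists:
  fixes Q :: "'a::{real_inner, complete_space} \<Rightarrow> 'a"
  assumes sa: "selfadjoint_op Q" and pos: "positive_op Q"
  obtains S where "selfadjoint_op S" and "positive_op S" and "S \<circ> S = Q"
    and "\<And>B x. bounded_linear B \<Longrightarrow> (\<And>z. B (Q z) = Q (B z)) \<Longrightarrow> B (S x) = S (B x)"
proof -
  interpret Q: bounded_linear Q
    using sa by (rule selfadjoint_opD)
  obtain c where c: "0 < c" "\<And>x. norm (Q x) \<le> norm x * c"
    using Q.pos_bounded by blast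
  define A where "A x = x - (1 / c) *\<^sub>R Q x" for x
  have blA: "bounded_linear A"
    unfolding A_def
    by (intro bounded_linear_sub bounded_linear_ident bounded_linear_scaleR_right
        bounded_linear_compose[OF bounded_linear_scaleR_right] Q.bounded_linear_axioms)
  then have saA: "selfadjoint_op A"
    using selfadjoint_opD(2)[OF sa] by (simp add: selfadjoint_op_def A_def inner_diff)
  have "Q x \<bullet> x \<le> c * (x \<bullet> x)" for x
  proof -
    have "Q x \<bullet> x \<le> norm (Q x) * norm x"
      by (rule norm_cauchy_schwarz)
    also have "\<dots> \<le> norm x * c * norm x"
      using c(2) by (intro mult_right_mono) auto
    finally show ?thesis
      by (simp add: dot_square_norm power2_eq_square mult_ac)
  qed
  then have "positive_op A"
    using c(1) by (simp add: positive_op_def A_def inner_diff pos_divide_le_eq mult.commute)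
  moreover have "A x \<bullet> x \<le> x \<bullet> x" for x
    using pos c(1) by (simp add: positive_op_def A_def inner_diff)
  ultimately obtain Y where saY: "selfadjoint_op Y" and Y_le: "\<And>x. norm (Y x) \<le> norm x"
    and fix_Y: "\<And>x. 2 *\<^sub>R Y x = A x + Y (Y x)"
    and comm: "\<And>B x. bounded_linear B \<Longrightarrow> (\<And>z. B (A z) = A (B z)) \<Longrightarrow> B (Y x) = Y (B x)"
    using contraction_sqrt_fixpoint[OF saA positive_op_contraction[OF saA]] by metis
  define S where "S x = sqrt c *\<^sub>R (x - Y x)" for x
  interpret Y: bounded_linear Y
    using saY by (rule selfadjoint_opD)
  have "bounded_linear S"
    unfolding S_def
    by (intro bounded_linear_compose[OF bounded_linear_scaleR_right] bounded_linear_sub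
        bounded_linear_ident Y.bounded_linear_axioms)
  then have "selfadjoint_op S"
    using selfadjoint_opD(2)[OF saY] by (simp add: selfadjoint_op_def S_def inner_diff)
  moreover have "positive_op S"
  proof -
    have "Y x \<bullet> x \<le> x \<bullet> x" for x
    proof -
      have "Y x \<bullet> x \<le> norm (Y x) * norm x"
        by (rule norm_cauchy_schwarz)
      also have "\<dots> \<le> norm x * norm x"
        using Y_le by (intro mult_right_mono) auto
      finally show ?thesis
        by (simp add: dot_square_norm power2_eq_square)
    qed
    then show ?thesis
      using c(1) by (simp add: positive_op_def S_def inner_diff)
  qed
  moreover have "S \<circ> S = Q"
  proof
    fix x
    have "S (S x) = c *\<^sub>R (x - 2 *\<^sub>R Y x + Y (Y x))"
      using c(1) by (simp add: S_def Y.scaleR Y.diff algebra_simps scaleR_2)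
    also have "\<dots> = c *\<^sub>R (x - A x)"
      by (simp add: fix_Y)
    also have "\<dots> = Q x"
      using c(1) by (simp add: A_def)
    finally show "(S \<circ> S) x = Q x"
      by simp
  qed
  moreover have "B (S x) = S (B x)"
    if B: "bounded_linear B" "\<And>z. B (Q z) = Q (B z)" for B x
  proof -
    interpret B: bounded_linear B
      by fact
    have "B (A z) = A (B z)" for z
      by (simp add: A_def B.diff B.scaleR B(2))
    then show ?thesis
      using comm[OF B(1)] by (simp add: S_def B.diff B.scaleR)
  qed
  ultimately show thesis
    using that by blast
qed

text \<open>Commutation yields \<open>(S + R) (S - R) x = 0\<close>. With
  \<open>y = (S - R) x\<close>, two nonnegative forms at \<open>y\<close> add up to zero, so
  \<open>S y = R y = 0\<close>, and moving \<open>S - R\<close> across the inner product gives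
  \<open>y \<bullet> y = 0\<close>.\<close>

lemma positive_sqrt_unique:
  assumes S: "selfadjoint_op S" "positive_op S" and R: "selfadjoint_op R" "positive_op R"
    and sq: "S \<circ> S = R \<circ> R" and comm: "\<And>x. R (S x) = S (R x)"
  shows "R = S"
proof
  fix x
  interpret S: bounded_linear S
    using S(1) by (rule selfadjoint_opD)
  interpret R: bounded_linear R
    using R(1) by (rule selfadjoint_opD)
  define y where "y = S x - R x"
  have "S y + R y = 0"
    using fun_cong[OF sq, of x] by (simp add: y_def S.diff R.diff comm)
  then have "S y \<bullet> y + R y \<bullet> y = 0"
    by (simp flip: inner_add_left)
  moreover have "0 \<le> S y \<bullet> y" "0 \<le> R y \<bullet> y"
    using S(2) R(2) by (auto simp: positive_op_def)
  ultimately have "S y = 0" "R y = 0"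
    using positive_op_eq_0[OF S, of y] positive_op_eq_0[OF R, of y] by simp_all
  then have "x \<bullet> (S y - R y) = 0"
    by simp
  then have "y \<bullet> y = 0"
    using selfadjoint_opD(2)[OF S(1), of x y] selfadjoint_opD(2)[OF R(1), of x y]
    by (simp add: y_def inner_diff_left inner_diff_right[of x])
  then show "R x = S x"
    by (simp add: y_def)
qed

lemma op_sqrt:
  fixes Q :: "'a::{real_inner, complete_space} \<Rightarrow> 'a"
  assumes "selfadjoint_op Q" and "positive_op Q"
  shows "selfadjoint_op (op_sqrt Q)" and "positive_op (op_sqrt Q)" and "op_sqrt Q \<circ> op_sqrt Q = Q"
proof -
  obtain S where S: "selfadjoint_op S" "positive_op S" "S \<circ> S = Q"
    and comm: "\<And>B x. bounded_linear B \<Longrightarrow> (\<And>z. B (Q z) = Q (B z)) \<Longrightarrow> B (S x) = S (B x)"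
    using positive_sqrt_exists[OF assms] by metis
  have "R = S" if R: "selfadjoint_op R" "positive_op R" "R \<circ> R = Q" for R
  proof (rule positive_sqrt_unique[OF S(1,2) R(1,2)])
    show "S \<circ> S = R \<circ> R"
      using S(3) R(3) by simp
    \<comment> \<open>A competing root \<open>R\<close> commutes with
      \<open>Q = R \<circ> R\<close>, hence with \<open>S\<close>.\<close>
    show "R (S x) = S (R x)" for x
      using comm[OF selfadjoint_opD(1)[OF R(1)]] R(3) by auto
  qed
  then have "\<exists>!S. selfadjoint_op S \<and> positive_op S \<and> S \<circ> S = Q"
    using S by blast
  then have "selfadjoint_op (op_sqrt Q) \<and> positive_op (op_sqrt Q) \<and> op_sqrt Q \<circ> op_sqrt Q = Q"
    unfolding op_sqrt_def by (rule theI')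
  then show "selfadjoint_op (op_sqrt Q)" "positive_op (op_sqrt Q)" "op_sqrt Q \<circ> op_sqrt Q = Q"
    by auto
qed

section \<open>The space \<open>V\<close> and the potential\<close>

text \<open>\<open>inv_into\<close> inverts only on values attained on the orthogonal complement of
  the kernel of \<open>Q\<close>. Every value of the root is attained there, since the kernel
  component of a preimage is sent to zero.\<close>

lemma op_sqrt_inv_sqrt:
  fixes Q :: "'a::{real_inner, complete_space} \<Rightarrow> 'a"
  assumes "selfadjoint_op Q" and "positive_op Q" and "v \<in> V_space Q"
  shows "op_sqrt Q (inv_sqrt Q v) = v"
proof -
  note S = op_sqrt[OF assms(1,2)]
  interpret Q: bounded_linear Q
    using assms(1) by (rule selfadjoint_opD)
  interpret S: bounded_linear "op_sqrt Q"
    using S(1) by (rule selfadjoint_opD)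
  have ker: "op_sqrt Q x = 0" if "Q x = 0" for x
  proof -
    have "op_sqrt Q x \<bullet> op_sqrt Q x = x \<bullet> Q x"
      using selfadjoint_opD(2)[OF S(1), of x "op_sqrt Q x"] fun_cong[OF S(3), of x] by simp
    then show ?thesis
      using that by simp
  qed
  obtain x where x: "v = op_sqrt Q x"
    using assms(3) by (auto simp: V_space_def)
  have "subspace {x. Q x = 0}"
    by (simp add: subspace_def Q.zero Q.add Q.scaleR)
  moreover have "closed {x. Q x = 0}"
    by (intro closed_Collect_eq continuous_on_const Q.continuous_on continuous_on_id)
  ultimately obtain p where p: "p \<in> {x. Q x = 0}\<^sup>\<bottom>" "x - p \<in> {x. Q x = 0}"
    using orthogonal_decomposition by blast
  then have "op_sqrt Q p = v"
    using ker[of "x - p"] by (simp add: S.diff x)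
  then show ?thesis
    unfolding inv_sqrt_def using p(1) by (intro f_inv_into_f) blast
qed

lemma norm_le_V_norm:
  fixes Q :: "'a::{real_inner, complete_space} \<Rightarrow> 'a"
  assumes "selfadjoint_op Q" and "positive_op Q"
  obtains C where "0 < C" and "\<And>v. v \<in> V_space Q \<Longrightarrow> norm v \<le> C * V_norm Q v"
proof -
  obtain C where "0 < C" "\<And>x. norm (op_sqrt Q x) \<le> norm x * C"
    using bounded_linear.pos_bounded[OF selfadjoint_opD(1)[OF op_sqrt(1)[OF assms]]] by blast
  then show thesis
    using that[of C] op_sqrt_inv_sqrt[OF assms] by (metis V_norm_def mult.commute)
qed

lemma subspace_V_space:
  fixes Q :: "'a::{real_inner, complete_space} \<Rightarrow> 'a"
  assumes "selfadjoint_op Q" and "positive_op Q"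
  shows "subspace (V_space Q)"
  unfolding V_space_def
  using selfadjoint_opD(1)[OF op_sqrt(1)[OF assms]] bounded_linear.linear linear_subspace_image
    subspace_UNIV by blast

lemma V_dual_diff:
  assumes "subspace (V_space Q)" and "y \<in> V_dual Q" and "v \<in> V_space Q" and "w \<in> V_space Q"
  shows "y (v - w) = y v - y w"
proof -
  have "y ((v - w) + w) = y (v - w) + y w"
    using assms subspace_diff unfolding V_dual_def by blast
  then show ?thesis
    by simp
qed

lemma V_dual_bounded:
  assumes "y \<in> V_dual Q"
  obtains K where "0 \<le> K" and "\<And>v. v \<in> V_space Q \<Longrightarrow> \<bar>y v\<bar> \<le> K * V_norm Q v"
proof -
  obtain K where K: "\<And>v. v \<in> V_space Q \<Longrightarrow> \<bar>y v\<bar> \<le> K * V_norm Q v"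
    using assms unfolding V_dual_def by blast
  \<comment> \<open>\<open>V_dual\<close> leaves the sign of the constant open; later monotonicity
    steps need it nonnegative.\<close>
  have "\<bar>y v\<bar> \<le> \<bar>K\<bar> * V_norm Q v" if "v \<in> V_space Q" for v
  proof -
    have "K * V_norm Q v \<le> \<bar>K\<bar> * V_norm Q v"
      by (intro mult_right_mono) (auto simp: V_norm_def)
    then show ?thesis
      using K[OF that] by simp
  qed
  then show thesis
    using that[of "\<bar>K\<bar>"] by simp
qed

section \<open>Estimates for the potential\<close>

text \<open>The difference of squares factors as an inner product, so both terms contain the
  increment \<open>F u - F v\<close>, which is controlled in \<open>V_norm\<close>.\<close>

lemma potential_diff:
  assumes "y (F u - F v) = y (F u) - y (F v)"
  shows "potential \<sigma> F u y - potential \<sigma> F v y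
    = ((F u - F v) \<bullet> (F u + F v) / 2 - y (F u - F v)) / \<sigma>\<^sup>2"
proof -
  have "(F u - F v) \<bullet> (F u + F v) = (norm (F u))\<^sup>2 - (norm (F v))\<^sup>2"
    by (simp add: power2_norm_eq_inner inner_add inner_diff inner_commute)
  then show ?thesis
    by (simp add: potential_def assms diff_divide_distrib)
qed

theorem proposition3p6:
  fixes \<sigma> :: real
    and Q :: "'y::{real_inner, polish_space} \<Rightarrow> 'y"
    and F :: "'x::{real_inner, polish_space} \<Rightarrow> 'y"
  assumes "\<sigma> > 0"
    and "selfadjoint_op Q" and "positive_op Q" and "trace_class Q"
    and "range F \<subseteq> V_space Q"
    and "lipschitz_on_bounded_sets (V_norm Q) F"
    and "\<exists>L0>0. \<forall>u. V_norm Q (F u - F 0) \<le> L0 * norm u"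
  shows "\<forall>y\<in>V_dual Q.
           lipschitz_on_bounded_sets norm (\<lambda>u. potential \<sigma> F u y) \<and>
           (\<exists>L\<ge>0. \<forall>u. potential \<sigma> F u y \<ge> potential \<sigma> F 0 y - L * norm u)"
proof
  fix y
  assume y: "y \<in> V_dual Q"
  obtain C where C: "0 < C" "\<And>v. v \<in> V_space Q \<Longrightarrow> norm v \<le> C * V_norm Q v"
    using norm_le_V_norm[OF assms(2,3)] by blast
  obtain K where K: "0 \<le> K" "\<And>v. v \<in> V_space Q \<Longrightarrow> \<bar>y v\<bar> \<le> K * V_norm Q v"
    using V_dual_bounded[OF y] by blast
  obtain L0 where L0: "0 < L0" "\<And>u. V_norm Q (F u - F 0) \<le> L0 * norm u"
    using assms(7) by blast
  note sub = subspace_V_space[OF assms(2,3)]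
  have FV: "F u \<in> V_space Q" for u
    using assms(5) by blast
  have FdV: "F u - F v \<in> V_space Q" for u v
    using sub FV by (simp add: subspace_diff)
  have pot: "potential \<sigma> F u y - potential \<sigma> F v y
      = ((F u - F v) \<bullet> (F u + F v) / 2 - y (F u - F v)) / \<sigma>\<^sup>2" for u v
    by (rule potential_diff) (rule V_dual_diff[OF sub y FV FV])
  have growth: "norm (F u - F 0) \<le> C * L0 * norm u" for u
  proof -
    have "C * V_norm Q (F u - F 0) \<le> C * (L0 * norm u)"
      using C(1) L0(2) by (intro mult_left_mono) auto
    then show ?thesis
      using C(2)[OF FdV, of u 0] by (simp add: mult.assoc)
  qed
  have "lipschitz_on_bounded_sets norm (\<lambda>u. potential \<sigma> F u y)"
    unfolding lipschitz_on_bounded_sets_def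
  proof (intro allI impI)
    fix r :: real
    assume "0 < r"
    then obtain L where L: "0 < L"
      "\<And>u v. u \<in> ball 0 r \<Longrightarrow> v \<in> ball 0 r \<Longrightarrow> V_norm Q (F u - F v) \<le> L * norm (u - v)"
      using assms(6) unfolding lipschitz_on_bounded_sets_def by blast
    \<comment> \<open>A bound for \<open>norm (F u)\<close> on the ball of radius \<open>r\<close>,
      from the linear growth of \<open>F\<close>.\<close>
    define M where "M = norm (F 0) + C * L0 * r"
    have "0 < M"
      using C(1) L0(1) \<open>0 < r\<close> by (simp add: M_def add_nonneg_pos)
    have FM: "norm (F u) \<le> M" if "u \<in> ball 0 r" for u
    proof -
      have "C * L0 * norm u \<le> C * L0 * r"
        using that C(1) L0(1) by (intro mult_left_mono) auto
      then show ?thesis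
        using growth[of u] norm_triangle_ineq2[of "F u" "F 0"] by (simp add: M_def)
    qed
    \<comment> \<open>In the constant, \<open>C * M\<close> comes from the quadratic term, where the
      2 of \<open>2 * M\<close> cancels against the division by 2, and \<open>K\<close> from the
      pairing.\<close>
    have "norm (potential \<sigma> F u y - potential \<sigma> F v y) \<le> (C * M + K) * L / \<sigma>\<^sup>2 * norm (u - v)"
      if uv: "u \<in> ball 0 r" "v \<in> ball 0 r" for u v
    proof -
      define N where "N = V_norm Q (F u - F v)"
      have "\<bar>(F u - F v) \<bullet> (F u + F v)\<bar> \<le> norm (F u - F v) * norm (F u + F v)"
        by (rule Cauchy_Schwarz_ineq2)
      also have "\<dots> \<le> (C * N) * (2 * M)"
      proof (intro mult_mono)
        show "norm (F u - F v) \<le> C * N"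
          unfolding N_def by (rule C(2)[OF FdV])
        show "norm (F u + F v) \<le> 2 * M"
          using norm_triangle_ineq[of "F u" "F v"] FM[OF uv(1)] FM[OF uv(2)] by simp
      qed (use C(1) in \<open>simp_all add: N_def V_norm_def\<close>)
      also have "\<dots> = 2 * (C * M * N)"
        by simp
      finally have "\<bar>(F u - F v) \<bullet> (F u + F v) / 2 - y (F u - F v)\<bar> \<le> C * M * N + K * N"
        using K(2)[OF FdV, of u v] unfolding N_def by linarith
      also have "\<dots> = (C * M + K) * N"
        by (simp add: algebra_simps)
      also have "\<dots> \<le> (C * M + K) * (L * norm (u - v))"
        unfolding N_def using L(2)[OF uv] C(1) K(1) \<open>0 < M\<close> by (intro mult_left_mono) auto
      finally show ?thesis
        unfolding pot by (simp add: divide_right_mono mult.assoc)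
    qed
    moreover have "0 < (C * M + K) * L / \<sigma>\<^sup>2"
      using C(1) K(1) L(1) \<open>0 < M\<close> assms(1) by (simp add: add_pos_nonneg)
    ultimately show "\<exists>L>0. \<forall>x1\<in>ball 0 r. \<forall>x2\<in>ball 0 r.
        norm (potential \<sigma> F x1 y - potential \<sigma> F x2 y) \<le> L * norm (x1 - x2)"
      by blast
  qed
  moreover have "potential \<sigma> F u y \<ge> potential \<sigma> F 0 y - (C * norm (F 0) + K) * L0 / \<sigma>\<^sup>2 * norm u" for u
  proof -
    define d where "d = F u - F 0"
    \<comment> \<open>Expanding around \<open>F 0\<close> isolates \<open>d \<bullet> d\<close>, the
      only term that may grow quadratically in \<open>u\<close>. It is nonnegative, so a lower bound
      may drop it and what remains is linear in \<open>norm u\<close>.\<close>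
    have "d \<bullet> (F u + F 0) = d \<bullet> d + 2 * (d \<bullet> F 0)"
      by (simp add: d_def inner_add inner_diff inner_commute)
    moreover have "\<bar>d \<bullet> F 0\<bar> \<le> (C * L0 * norm u) * norm (F 0)"
      using Cauchy_Schwarz_ineq2[of d "F 0"] mult_right_mono[OF growth[of u], of "norm (F 0)"]
      by (simp add: d_def)
    moreover have "\<bar>y d\<bar> \<le> K * (L0 * norm u)"
      using K(2)[OF FdV, of u 0] mult_left_mono[OF L0(2) K(1), of u] by (simp add: d_def)
    moreover have "0 \<le> d \<bullet> d"
      by simp
    ultimately have "- ((C * L0 * norm u) * norm (F 0)) - K * (L0 * norm u)
        \<le> d \<bullet> (F u + F 0) / 2 - y d"
      by linarith
    then have "- ((C * norm (F 0) + K) * L0 * norm u) \<le> d \<bullet> (F u + F 0) / 2 - y d"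
      by (simp only: algebra_simps)
    then have "- ((C * norm (F 0) + K) * L0 * norm u) / \<sigma>\<^sup>2 \<le> potential \<sigma> F u y - potential \<sigma> F 0 y"
      unfolding pot d_def by (rule divide_right_mono) simp
    then show ?thesis
      by simp
  qed
  moreover have "0 \<le> (C * norm (F 0) + K) * L0 / \<sigma>\<^sup>2"
    using C(1) K(1) L0(1) by simp
  ultimately show "lipschitz_on_bounded_sets norm (\<lambda>u. potential \<sigma> F u y) \<and>
      (\<exists>L\<ge>0. \<forall>u. potential \<sigma> F u y \<ge> potential \<sigma> F 0 y - L * norm u)"
    by blast
qed

end
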